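(* There is no holomorphic self-map $\varphi$ of $\mathbb{D}$ such that the composition operator $C_\varphi f=f\circ\varphi$ is an isometry from $H^\infty(\mathbb{D})$ into $\mathcal{B}(\mathbb{D})$.
   Context: $\mathbb{D}$ is the open unit disk in $\mathbb{C}$, and $H^\infty(\mathbb{D})$ is the space of bounded holomorphic functions on $\mathbb{D}$ with the supremum norm $\|\cdot\|_\infty$. The Bloch space $\mathcal{B}(\mathbb{D})$ is the set of holomorphic functions $f$ on $\mathbb{D}$ with $\beta_f=\sup_{z\in\mathbb{D}}(1-|z|^2)|f'(z)|<\infty$, with norm $\|f\|_{\mathcal{B}}=|f(0)|+\beta_f$. A linear operator $T:H^\infty(\mathbb{D})\to\mathcal{B}(\mathbb{D})$ is an isometry if $\|Tf\|_{\mathcal{B}}=\|f\|_\infty$ for all $f\in H^\infty(\mathbb{D})$ (surjectivity is not required). *)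

theory Defs
  imports "HOL-Complex_Analysis.Complex_Analysis"
begin

text \<open>Functions on the unit disk are represented by total functions \<^typ>\<open>complex \<Rightarrow> complex\<close>;
  all notions below depend only on their values on the disk.\<close>

abbreviation unit_disk :: "complex set" where
  "unit_disk \<equiv> ball 0 1"

definition Hinf :: "(complex \<Rightarrow> complex) set" where
  "Hinf = {f. f holomorphic_on unit_disk \<and> bounded (f ` unit_disk)}"

definition Hinf_norm :: "(complex \<Rightarrow> complex) \<Rightarrow> real" where
  "Hinf_norm f = (SUP z\<in>unit_disk. cmod (f z))"

definition Bloch :: "(complex \<Rightarrow> complex) set" where
  "Bloch = {f. f holomorphic_on unit_disk \<and>
               bdd_above ((\<lambda>z. (1 - (cmod z)\<^sup>2) * cmod (deriv f z)) ` unit_disk)}"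

definition Bloch_seminorm :: "(complex \<Rightarrow> complex) \<Rightarrow> real" where
  "Bloch_seminorm f = (SUP z\<in>unit_disk. (1 - (cmod z)\<^sup>2) * cmod (deriv f z))"

definition Bloch_norm :: "(complex \<Rightarrow> complex) \<Rightarrow> real" where
  "Bloch_norm f = cmod (f 0) + Bloch_seminorm f"

text \<open>Linearity is required on the disk only. Together with norm preservation it implies that
  functions agreeing on the disk have images agreeing on the disk.\<close>

definition linear_Hinf_Bloch :: "((complex \<Rightarrow> complex) \<Rightarrow> complex \<Rightarrow> complex) \<Rightarrow> bool" where
  "linear_Hinf_Bloch T \<longleftrightarrow>
     (\<forall>f\<in>Hinf. T f \<in> Bloch) \<and>
     (\<forall>f\<in>Hinf. \<forall>g\<in>Hinf. \<forall>z\<in>unit_disk. T (\<lambda>w. f w + g w) z = T f z + T g z) \<and>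
     (\<forall>c. \<forall>f\<in>Hinf. \<forall>z\<in>unit_disk. T (\<lambda>w. c * f w) z = c * T f z)"

definition isometry_Hinf_Bloch :: "((complex \<Rightarrow> complex) \<Rightarrow> complex \<Rightarrow> complex) \<Rightarrow> bool" where
  "isometry_Hinf_Bloch T \<longleftrightarrow>
     linear_Hinf_Bloch T \<and> (\<forall>f\<in>Hinf. Bloch_norm (T f) = Hinf_norm f)"

definition holomorphic_self_map :: "(complex \<Rightarrow> complex) \<Rightarrow> bool" where
  "holomorphic_self_map \<phi> \<longleftrightarrow> \<phi> holomorphic_on unit_disk \<and> \<phi> ` unit_disk \<subseteq> unit_disk"

definition composition_operator ::
    "(complex \<Rightarrow> complex) \<Rightarrow> (complex \<Rightarrow> complex) \<Rightarrow> complex \<Rightarrow> complex" where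
  "composition_operator \<phi> f = f \<circ> \<phi>"

end

theory Submission
  imports Defs
begin

text \<open>The seminorm \<^const>\<open>Bloch_seminorm\<close> ignores additive constants, so an isometry forces
  \<open>\<parallel>f + c\<parallel> - \<bar>f a + c\<bar> = \<parallel>f\<parallel> - \<bar>f a\<bar>\<close> for all \<open>f\<close> and \<open>c\<close>, where \<open>a = \<phi> 0\<close>. Taking \<open>f z = z\<close> and
  \<open>c = 1, -1\<close> gives \<open>\<bar>a + 1\<bar>, \<bar>a - 1\<bar> \<ge> 1 + \<bar>a\<bar>\<close>, hence \<open>a = 0\<close> by the parallelogram law. Then
  \<open>f z = z + z^2\<close>, \<open>c = -1\<close> is contradictory, since \<open>\<parallel>f\<parallel> \<ge> 2\<close> but \<open>\<parallel>f - 1\<parallel> < 3\<close>.\<close>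

text \<open>The bound on the open disk extends to its closure by continuity. This allows lower
  bounds for \<open>Hinf_norm\<close> to be read off at the boundary points 1 and -1.\<close>

lemma norm_le_Hinf_norm:
  assumes "continuous_on (cball 0 1) f" and "z \<in> cball 0 1"
  shows "cmod (f z) \<le> Hinf_norm f"
proof -
  have "compact ((\<lambda>z. cmod (f z)) ` cball 0 1)"
    using assms(1) by (intro compact_continuous_image continuous_intros) auto
  then have "bdd_above ((\<lambda>z. cmod (f z)) ` cball 0 1)"
    by (intro bounded_imp_bdd_above compact_imp_bounded)
  then have "bdd_above ((\<lambda>z. cmod (f z)) ` unit_disk)"
    by (rule bdd_above_mono) auto
  then have "cmod (f w) \<le> Hinf_norm f" if "w \<in> unit_disk" for w
    unfolding Hinf_norm_def using that by (rule cSUP_upper2) auto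
  moreover have "closure unit_disk = cball (0::complex) 1"
    by simp
  ultimately show ?thesis
    using continuous_on_closure_norm_le[of unit_disk f "Hinf_norm f" z] assms by auto
qed

lemma Hinf_norm_le:
  assumes "\<And>z. cmod z < 1 \<Longrightarrow> cmod (f z) \<le> M"
  shows "Hinf_norm f \<le> M"
  unfolding Hinf_norm_def using assms by (intro cSUP_least) auto

lemma mem_Hinf:
  assumes "continuous_on (cball 0 1) f" and "f holomorphic_on unit_disk"
  shows "f \<in> Hinf"
proof -
  have "bounded (f ` cball 0 1)"
    using assms(1) by (intro compact_imp_bounded compact_continuous_image) auto
  then have "bounded (f ` unit_disk)"
    by (rule bounded_subset) auto
  with assms(2) show ?thesis
    by (simp add: Hinf_def)
qed

lemma Bloch_seminorm_add_const:
  assumes "f holomorphic_on unit_disk"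
  shows "Bloch_seminorm (\<lambda>z. f z + c) = Bloch_seminorm f"
proof -
  have "deriv (\<lambda>z. f z + c) z = deriv f z" if "z \<in> unit_disk" for z
    using holomorphic_on_imp_differentiable_at[OF assms open_ball that] by simp
  then show ?thesis
    unfolding Bloch_seminorm_def by (intro SUP_cong) auto
qed

text \<open>Both sides equal the Bloch seminorm of \<open>f \<circ> \<phi>\<close>, which the shift
  by \<open>c\<close> leaves unchanged.\<close>

lemma isometry_composition_add_const:
  assumes \<phi>: "holomorphic_self_map \<phi>"
    and iso: "isometry_Hinf_Bloch (composition_operator \<phi>)"
    and cont: "continuous_on (cball 0 1) f" and hol: "f holomorphic_on unit_disk"
  shows "Hinf_norm (\<lambda>w. f w + c) - cmod (f (\<phi> 0) + c) = Hinf_norm f - cmod (f (\<phi> 0))"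
proof -
  have "f \<in> Hinf" "(\<lambda>w. f w + c) \<in> Hinf"
    using cont hol by (auto intro!: mem_Hinf continuous_intros holomorphic_intros)
  then have "Bloch_norm (composition_operator \<phi> f) = Hinf_norm f"
      "Bloch_norm (composition_operator \<phi> (\<lambda>w. f w + c)) = Hinf_norm (\<lambda>w. f w + c)"
    using iso by (auto simp: isometry_Hinf_Bloch_def)
  moreover have "f \<circ> \<phi> holomorphic_on unit_disk"
    using \<phi> hol holomorphic_on_compose_gen by (auto simp: holomorphic_self_map_def)
  then have "Bloch_seminorm (\<lambda>w. f (\<phi> w) + c) = Bloch_seminorm (\<lambda>w. f (\<phi> w))"
    using Bloch_seminorm_add_const[of "f \<circ> \<phi>" c] by (simp add: o_def)
  ultimately show ?thesis
    by (simp add: Bloch_norm_def composition_operator_def o_def)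
qed

lemma parallelogram_cmod_one:
  "(cmod (z + 1))\<^sup>2 + (cmod (z - 1))\<^sup>2 = 2 + 2 * (cmod z)\<^sup>2"
  unfolding cmod_power2 by (simp add: power2_eq_square algebra_simps)

text \<open>By the parallelogram law one of \<open>z + 1\<close>, \<open>z - 1\<close> has modulus
  at most sqrt 2, and the polynomial can be regrouped around either one. Any bound below 3 would
  serve the final contradiction.\<close>

lemma norm_quadratic_le:
  assumes "cmod z < 1"
  shows "cmod (z + z\<^sup>2 - 1) \<le> 5 / 2"
proof -
  have sq: "(cmod z)\<^sup>2 \<le> 1"
    using assms by (simp add: power_le_one)
  with parallelogram_cmod_one[of z]
  consider "(cmod (z + 1))\<^sup>2 \<le> 2" | "(cmod (z - 1))\<^sup>2 \<le> 2"
    by linarith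
  then show ?thesis
  proof cases
    case 1
    \<comment> \<open>Here 3/2 is a rational upper bound for sqrt 2; adding 1 yields 5/2.\<close>
    then have "(cmod (z + 1))\<^sup>2 \<le> (3 / 2)\<^sup>2"
      by (simp add: power_divide)
    then have "cmod (z + 1) \<le> 3 / 2"
      by (rule power2_le_imp_le) simp
    moreover have "cmod (z * (z + 1)) \<le> cmod (z + 1)"
      using assms by (simp add: norm_mult mult_left_le_one_le)
    moreover have "z + z\<^sup>2 - 1 = z * (z + 1) - 1"
      by (simp add: power2_eq_square algebra_simps)
    ultimately show ?thesis
      using norm_triangle_ineq4[of "z * (z + 1)" 1] by simp
  next
    case 2
    then have "(cmod (z - 1))\<^sup>2 \<le> (3 / 2)\<^sup>2"
      by (simp add: power_divide)
    then have "cmod (z - 1) \<le> 3 / 2"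
      by (rule power2_le_imp_le) simp
    \<comment> \<open>Regrouped as \<open>z\<^sup>2 + (z - 1)\<close>, with the first term of
      modulus at most 1.\<close>
    moreover have "cmod (z + z\<^sup>2 - 1) \<le> (cmod z)\<^sup>2 + cmod (z - 1)"
      using norm_triangle_ineq[of "z\<^sup>2" "z - 1"] by (simp add: norm_power algebra_simps)
    ultimately show ?thesis
      using sq by linarith
  qed
qed

theorem theorem6p4:
  shows "\<not> (\<exists>\<phi>. holomorphic_self_map \<phi> \<and> isometry_Hinf_Bloch (composition_operator \<phi>))"
proof
  assume "\<exists>\<phi>. holomorphic_self_map \<phi> \<and> isometry_Hinf_Bloch (composition_operator \<phi>)"
  then obtain \<phi> where \<phi>: "holomorphic_self_map \<phi>"
    and iso: "isometry_Hinf_Bloch (composition_operator \<phi>)"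
    by blast
  define a where "a = \<phi> 0"
  note shift = isometry_composition_add_const[OF \<phi> iso, folded a_def]
  have "Hinf_norm (\<lambda>w. w) \<le> 1"
    by (rule Hinf_norm_le) simp
  moreover have "Hinf_norm (\<lambda>w. w + 1) \<ge> 2"
    using norm_le_Hinf_norm[of "\<lambda>w. w + 1" 1] by (simp add: continuous_intros)
  moreover have "Hinf_norm (\<lambda>w. w + (-1)) \<ge> 2"
    using norm_le_Hinf_norm[of "\<lambda>w. w + (-1)" "-1"] by (simp add: continuous_intros)
  ultimately have "cmod (a + 1) \<ge> 1 + cmod a" "cmod (a - 1) \<ge> 1 + cmod a"
    using shift[of "\<lambda>w. w" 1] shift[of "\<lambda>w. w" "-1"] by simp_all
  then have "(cmod (a + 1))\<^sup>2 \<ge> (1 + cmod a)\<^sup>2" "(cmod (a - 1))\<^sup>2 \<ge> (1 + cmod a)\<^sup>2"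
    by (simp_all add: power_mono)
  then have "2 + 2 * (cmod a)\<^sup>2 \<ge> 2 * (1 + cmod a)\<^sup>2"
    using parallelogram_cmod_one[of a] by linarith
  \<comment> \<open>Expanding the squares leaves \<open>4 * cmod a \<le> 0\<close>.\<close>
  then have "a = 0"
    by (simp add: power2_eq_square algebra_simps)
  moreover have "Hinf_norm (\<lambda>w. w + w\<^sup>2) \<ge> 2"
    using norm_le_Hinf_norm[of "\<lambda>w. w + w\<^sup>2" 1] by (simp add: continuous_intros)
  moreover have "Hinf_norm (\<lambda>w. w + w\<^sup>2 + (-1)) \<le> 5 / 2"
    using norm_quadratic_le by (intro Hinf_norm_le) simp
  \<comment> \<open>With \<open>a = 0\<close> the shift identity for \<open>c = -1\<close> reads:
    the norm of \<open>w + w\<^sup>2 - 1\<close> is 1 plus that of \<open>w + w\<^sup>2\<close>,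
    hence at least 3, against the bound 5/2.\<close>
  ultimately show False
    using shift[of "\<lambda>w. w + w\<^sup>2" "-1"] by (simp add: continuous_intros holomorphic_intros)
qed

end
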